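(* Let $F_k:\mathbb{R}^n\to\mathcal{I}$ ($k\in K:=\{1,\dots,m\}$) and $g_j:\mathbb{R}^n\to\mathbb{R}$ ($j\in J:=\{1,\dots,p\}$) be locally Lipschitz continuous, $F=(F_1,\dots,F_m)$, $S:=\{u\in\mathbb{R}^n:g_j(u)\le0,\ \forall j\in J\}$. Let $\varepsilon=(\varepsilon_1,\dots,\varepsilon_m)\in\mathbb{R}^m_+\setminus\{0\}$ and $\overline{u}\in M(F,S,\varepsilon)$. Given $\delta>0$, assume that BCQ holds at every point of $\overline{B}(\overline{u},\delta):=\{z\in S:\|z-\overline u\|\le\delta\}$. Then there exist $x_\delta\in \overline{B}(\overline{u},\delta)$, $\lambda\in\mathbb{R}^m_+$ with $\sum_{k\in K}\lambda_k=1$, and $\mu\in\mathbb{R}^p_+$ such that $$0\in\sum_{k\in K}\lambda_k\partial^0 F_k(x_\delta)+\sum_{j\in I(x_\delta)}\mu_j\partial^0 g_j(x_\delta)+\frac{1}{\delta}\max_{k\in K}\{\varepsilon_k\}\,\mathbb{B}^n,\qquad \mu_jg_j(x_\delta)=0\ \ \forall j\in J.$$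
   Context: $\mathcal{I}$ is the set of all compact intervals $[\underline q,\overline q]$ with $\underline q\le\overline q$ real. For $Q=[\underline q,\overline q]\in\mathcal I$ put $q^c=\frac{\underline q+\overline q}{2}$ and $q^w=\frac{\overline q-\underline q}{2}$. Addition: $[\underline q,\overline q]+[\underline r,\overline r]=[\underline q+\underline r,\overline q+\overline r]$. Order: $Q\prec_{CW}R$ iff $q^c<r^c$ and $q^w<r^w$. $\mathbb{R}^m_+$ is the nonnegative orthant; $\mathbb{B}^n$ is the closed unit ball of $\mathbb{R}^n$; $\mathrm{co}$ denotes convex hull. An interval-valued function $f=[\underline f,\overline f]:\mathbb{R}^n\to\mathcal I$ is locally Lipschitz continuous if every point has a neighbourhood $U$ and $L>0$ with $\max\{|\underline f(u_1)-\underline f(u_2)|,|\overline f(u_1)-\overline f(u_2)|\}\le L\|u_1-u_2\|$ for $u_1,u_2\in U$ (equivalently, $\underline f,\overline f$ are locally Lipschitz). Write $f^c=\frac{\underline f+\overline f}{2}$, $f^w=\frac{\overline f-\underline f}{2}$. For locally Lipschitz $\psi:\mathbb{R}^n\to\mathbb{R}$, $\psi^0(z;w)=\limsup_{u\to z,\,t\to0^+}\frac{\psi(u+tw)-\psi(u)}{t}$ and $\partial^0\psi(z)=\{z^*\in\mathbb{R}^n:\langle z^*,w\rangle\le\psi^0(z;w)\ \forall w\}$ (Clarke gradient). For a locally Lipschitz interval-valued $f$, the weakly generalized gradient is $\partial^0f(u):=\mathrm{co}(\partial^0f^c(u)\cup\partial^0f^w(u))$. $M(F,S,\varepsilon)$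 is the set of $z_0\in S$ for which there is no $z\in S$ with $F_k(z)+[0,\varepsilon_k]\prec_{CW}F_k(z_0)$ for all $k\in K$. For $u\in S$, $I(u):=\{j\in J:g_j(u)=0\}$. BCQ holds at $u\in S$ if there is no $\mu\in\mathbb{R}^p_+\setminus\{0\}$ with $\mu_j\ge 0$ for $j\in I(u)$, $\mu_j=0$ for $j\notin I(u)$ and $0\in\sum_{j\in J}\mu_j\partial^0g_j(u)$. A sum over an empty index set is $\{0\}$. *)

theory Defs
  imports "HOL-Analysis.Analysis" "HOL-Library.Interval"
begin

definition center :: "real interval \<Rightarrow> real"
  where "center Q = (lower Q + upper Q) / 2"

definition half_width :: "real interval \<Rightarrow> real"
  where "half_width Q = (upper Q - lower Q) / 2"

definition less_CW :: "real interval \<Rightarrow> real interval \<Rightarrow> bool"  (infix \<open>\<prec>\<^sub>C\<^sub>W\<close> 50)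
  where "Q \<prec>\<^sub>C\<^sub>W R \<longleftrightarrow> center Q < center R \<and> half_width Q < half_width R"

definition locally_Lipschitz :: "('a::metric_space \<Rightarrow> real) \<Rightarrow> bool"
  where "locally_Lipschitz \<psi> \<longleftrightarrow>
    (\<forall>x. \<exists>U L. open U \<and> x \<in> U \<and> L > 0 \<and> L-lipschitz_on U \<psi>)"

definition locally_Lipschitz_ivl :: "('a::real_normed_vector \<Rightarrow> real interval) \<Rightarrow> bool"
  where "locally_Lipschitz_ivl f \<longleftrightarrow>
    (\<forall>x. \<exists>U L. open U \<and> x \<in> U \<and> L > 0 \<and>
      (\<forall>u1\<in>U. \<forall>u2\<in>U. max \<bar>lower (f u1) - lower (f u2)\<bar> \<bar>upper (f u1) - upper (f u2)\<bar>
        \<le> L * norm (u1 - u2)))"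

text \<open>
  The upper limit is taken in the extended reals, where it always exists; it is finite
  when \<open>\<psi>\<close> is locally Lipschitz. The base point \<open>u\<close> may equal \<open>z\<close>, hence
  \<open>nhds z\<close> and not \<open>at z\<close>.
\<close>

definition Clarke_dderiv :: "('a::real_normed_vector \<Rightarrow> real) \<Rightarrow> 'a \<Rightarrow> 'a \<Rightarrow> ereal"
  where "Clarke_dderiv \<psi> z w =
    Limsup (nhds z \<times>\<^sub>F at_right 0) (\<lambda>(u, t). ereal ((\<psi> (u + t *\<^sub>R w) - \<psi> u) / t))"

definition Clarke_gradient :: "('a::real_inner \<Rightarrow> real) \<Rightarrow> 'a \<Rightarrow> 'a set"
  where "Clarke_gradient \<psi> z = {zs. \<forall>w. ereal (zs \<bullet> w) \<le> Clarke_dderiv \<psi> z w}"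

definition weak_gradient :: "('a::real_inner \<Rightarrow> real interval) \<Rightarrow> 'a \<Rightarrow> 'a set"
  where "weak_gradient f u =
    convex hull (Clarke_gradient (\<lambda>v. center (f v)) u \<union> Clarke_gradient (\<lambda>v. half_width (f v)) u)"

text \<open>
  Finite families are functions on \<open>nat\<close>; only their values on the index sets \<open>K\<close> and \<open>J\<close>
  matter. \<open>Interval (0, \<epsilon> k)\<close> denotes \<open>[0, \<epsilon>\<^sub>k]\<close> only for \<open>\<epsilon> k \<ge> 0\<close>.
\<close>

definition approx_solutions ::
  "nat set \<Rightarrow> (nat \<Rightarrow> 'a \<Rightarrow> real interval) \<Rightarrow> 'a set \<Rightarrow> (nat \<Rightarrow> real) \<Rightarrow> 'a set"
  where "approx_solutions K F S \<epsilon> =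
    {z0 \<in> S. \<not> (\<exists>z\<in>S. \<forall>k\<in>K. F k z + Interval (0, \<epsilon> k) \<prec>\<^sub>C\<^sub>W F k z0)}"

definition feasible_set :: "nat set \<Rightarrow> (nat \<Rightarrow> 'a \<Rightarrow> real) \<Rightarrow> 'a set"
  where "feasible_set J g = {u. \<forall>j\<in>J. g j u \<le> 0}"

definition active :: "nat set \<Rightarrow> (nat \<Rightarrow> 'a \<Rightarrow> real) \<Rightarrow> 'a \<Rightarrow> nat set"
  where "active J g u = {j \<in> J. g j u = 0}"

text \<open>
  Sums of sets, here and below, are the Minkowski sums of \<^theory>\<open>HOL-Library.Set_Algebras\<close>;
  in particular, the empty sum is \<open>{0}\<close>.
\<close>

definition BCQ :: "nat set \<Rightarrow> (nat \<Rightarrow> 'a::real_inner \<Rightarrow> real) \<Rightarrow> 'a \<Rightarrow> bool"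
  where "BCQ J g u \<longleftrightarrow>
    \<not> (\<exists>\<mu> :: nat \<Rightarrow> real. (\<forall>j\<in>J. \<mu> j \<ge> 0) \<and> (\<exists>j\<in>J. \<mu> j \<noteq> 0) \<and>
        (\<forall>j \<in> J - active J g u. \<mu> j = 0) \<and>
        0 \<in> (\<Sum>j\<in>J. (\<lambda>v. \<mu> j *\<^sub>R v) ` Clarke_gradient (g j) u))"

end

theory Submission
  imports Defs
begin

text \<open>
  Put \<open>c = max \<epsilon>\<^sub>k / (2\<delta>)\<close> and let \<open>\<Phi>(z)\<close> be the largest of the numbers
  \<open>F\<^sub>k\<^sup>c(z) - F\<^sub>k\<^sup>c(u) + \<epsilon>\<^sub>k/2\<close> and \<open>F\<^sub>k\<^sup>w(z) - F\<^sub>k\<^sup>w(u) + \<epsilon>\<^sub>k/2\<close>, where \<open>u\<close> is the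
  approximate solution. Then \<open>\<Phi> \<ge> 0\<close> on \<open>S\<close> and \<open>\<Phi>(u) \<le> c\<delta>\<close>, so a minimizer \<open>x\<close> of
  \<open>\<Phi> + c\<parallel>\<sqdot> - u\<parallel>\<close> over the compact set \<open>S \<inter> B(u, \<delta>)\<close> is automatically one over \<open>S\<close>; in finite
  dimension this replaces Ekeland's principle. Hence the maximum of \<open>\<Phi> - \<Phi>(x) + c\<parallel>\<sqdot> - x\<parallel>\<close> and of all
  \<open>g\<^sub>j\<close> is nonnegative everywhere. If \<open>0\<close> were not in the convex hull of the gradients
  involved, the point of that hull closest to \<open>0\<close>, negated, would be a direction of descent for all of
  these functions at once. BCQ excludes that the resulting multipliers live on the constraints only.
\<close>

section \<open>Sublinear functions as support functions\<close>

text \<open>A finite-dimensional Hahn-Banach theorem: a separating hyperplane, once shown not to be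
  vertical, is the graph of the linear form sought. Asking only for a value above
  \<open>r < p w0\<close> lets strict separation of a point from a closed set suffice.\<close>

lemma sublinear_dominated_linear:
  fixes p :: "'a::euclidean_space \<Rightarrow> real"
  assumes sub: "\<And>x y. p (x + y) \<le> p x + p y"
    and hom: "\<And>s x. s > 0 \<Longrightarrow> p (s *\<^sub>R x) = s * p x"
    and r: "r < p w0"
  shows "\<exists>v. (\<forall>w. v \<bullet> w \<le> p w) \<and> r < v \<bullet> w0"
proof -
  have zero: "p 0 = 0"
    using hom[of 2 0] by simp
  have cvx: "convex_on UNIV p"
  proof (rule convex_onI)
    fix t :: real and x y :: 'a
    assume "0 < t" "t < 1"
    thus "p ((1 - t) *\<^sub>R x + t *\<^sub>R y) \<le> (1 - t) * p x + t * p y"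
      using sub[of "(1 - t) *\<^sub>R x" "t *\<^sub>R y"] hom[of "1 - t" x] hom[of t y] by simp
  qed simp
  \<comment> \<open>Separate \<open>(w0, r)\<close> from the epigraph, a closed convex cone.\<close>
  define E where "E = epigraph UNIV p"
  have "closed E"
  proof -
    have "continuous_on UNIV p"
      using cvx by (intro convex_on_continuous) auto
    hence "continuous_on UNIV (\<lambda>x :: 'a \<times> real. p (fst x))"
      by (rule continuous_on_compose2) (auto intro!: continuous_intros)
    hence "closed {x :: 'a \<times> real. p (fst x) \<le> snd x}"
      by (intro closed_Collect_le continuous_intros)
    thus ?thesis by (simp add: E_def epigraph_def)
  qed
  moreover have "convex E" using cvx by (simp add: E_def convex_epigraph)
  moreover have "(w0, r) \<notin> E" using r by (simp add: E_def mem_epigraph)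
  ultimately obtain ab \<beta> where "ab \<bullet> (w0, r) < \<beta>" "\<forall>x\<in>E. ab \<bullet> x > \<beta>"
    using separating_hyperplane_closed_point[of E "(w0, r)"] by auto
  then obtain a b where lt: "a \<bullet> w0 + b * r < \<beta>"
    and gt: "\<And>w s. p w \<le> s \<Longrightarrow> \<beta> < a \<bullet> w + b * s"
    by (cases ab) (auto simp: E_def epigraph_def)
  have "\<beta> < 0" using gt[of 0 0] zero by simp
  \<comment> \<open>A linear form bounded below on a cone is nonnegative there: a point of negative
    value could be rescaled within the cone until its value is exactly \<open>\<beta>\<close>,
    against strict separation.\<close>
  have nonneg: "0 \<le> a \<bullet> w + b * s" if "p w \<le> s" for w s
  proof (rule ccontr)
    assume neg: "\<not> ?thesis"
    define t where "t = \<beta> / (a \<bullet> w + b * s)"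
    have "t > 0" using neg \<open>\<beta> < 0\<close> by (simp add: t_def divide_neg_neg)
    have "\<beta> < a \<bullet> (t *\<^sub>R w) + b * (t * s)"
      using that \<open>t > 0\<close> by (intro gt) (simp add: hom)
    also have "\<dots> = t * (a \<bullet> w + b * s)" by (simp add: algebra_simps)
    also have "\<dots> = \<beta>" using neg by (simp add: t_def)
    finally show False by simp
  qed
  \<comment> \<open>Comparing the points \<open>(w0, r)\<close> and \<open>(w0, p w0)\<close> on one
    vertical line rules out a vertical hyperplane.\<close>
  have "b * r < b * p w0"
    using nonneg[of w0 "p w0"] lt \<open>\<beta> < 0\<close> by linarith
  hence "b > 0" using r by (simp add: mult_less_cancel_left)
  define v where "v = (- 1 / b) *\<^sub>R a"
  have "v \<bullet> w \<le> p w" for w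
    using nonneg[of w "p w"] \<open>b > 0\<close> by (simp add: v_def field_simps)
  moreover have "r < v \<bullet> w0"
    using lt \<open>\<beta> < 0\<close> \<open>b > 0\<close> by (simp add: v_def field_simps)
  ultimately show ?thesis by blast
qed

section \<open>The Clarke directional derivative is finite and sublinear\<close>

lemma Clarke_filter_not_bot: "nhds z \<times>\<^sub>F at_right (0::real) \<noteq> bot"
  by (simp add: prod_filter_eq_bot trivial_limit_at_right_real)

lemma eventually_Clarke_filter_pos:
  "\<forall>\<^sub>F (u, t) in nhds z \<times>\<^sub>F at_right (0::real). t > 0"
  using eventually_prod2[of "nhds z" "\<lambda>t. t > 0" "at_right (0::real)"]
  by (simp add: eventually_at_right_less)

text \<open>The base point in the Clarke limit is free, so it may move along with the step. Shifting
  it (\<open>s = 1\<close>) gives subadditivity, rescaling the step (\<open>w = 0\<close>) gives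
  homogeneity.\<close>

lemma filterlim_Clarke_shift:
  fixes z w :: "'a::real_normed_vector"
  assumes "s > 0"
  shows "filterlim (\<lambda>(u, t). (u + t *\<^sub>R w, s * t)) (nhds z \<times>\<^sub>F at_right 0) (nhds z \<times>\<^sub>F at_right (0::real))"
proof -
  let ?F = "nhds z \<times>\<^sub>F at_right (0::real)"
  have f: "((\<lambda>x. fst x) \<longlongrightarrow> z) ?F" by (rule filterlim_fst)
  have "filterlim snd (at_right 0) ?F" by (rule filterlim_snd)
  hence s: "((\<lambda>x. snd x) \<longlongrightarrow> 0) ?F"
    by (simp add: filterlim_at)
  have "((\<lambda>x. fst x + snd x *\<^sub>R w) \<longlongrightarrow> z + 0 *\<^sub>R w) ?F"
    by (intro tendsto_intros f s)
  moreover have "((\<lambda>x. s * snd x) \<longlongrightarrow> s * 0) ?F"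
    by (intro tendsto_intros f s)
  moreover have "\<forall>\<^sub>F x in ?F. s * snd x \<in> {0<..} \<and> s * snd x \<noteq> 0"
    using eventually_Clarke_filter_pos by eventually_elim (use assms in auto)
  ultimately show ?thesis
    by (simp add: case_prod_unfold filterlim_Pair filterlim_at)
qed

lemma Clarke_dderiv_le:
  assumes "\<forall>\<^sub>F (u, t) in nhds z \<times>\<^sub>F at_right 0. (\<psi> (u + t *\<^sub>R w) - \<psi> u) / t \<le> r"
  shows "Clarke_dderiv \<psi> z w \<le> ereal r"
  unfolding Clarke_dderiv_def
  by (rule Limsup_bounded) (use assms in \<open>simp add: case_prod_unfold\<close>)

lemma Clarke_dderiv_lessD:
  assumes "Clarke_dderiv \<psi> z w < ereal r"
  shows "\<forall>\<^sub>F (u, t) in nhds z \<times>\<^sub>F at_right 0. (\<psi> (u + t *\<^sub>R w) - \<psi> u) / t < r"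
  using Limsup_lessD[OF assms[unfolded Clarke_dderiv_def]] by (simp add: case_prod_unfold)

text \<open>Eventually both ends of the step lie in one neighbourhood with Lipschitz constant
  \<open>L\<close>. That \<open>L\<close> is independent of \<open>w\<close> later makes the Clarke
  gradient bounded.\<close>

lemma Clarke_dderiv_bound:
  assumes "locally_Lipschitz \<psi>"
  obtains L where "\<And>w. \<bar>Clarke_dderiv \<psi> z w\<bar> \<le> ereal (L * norm w)"
proof -
  let ?F = "nhds z \<times>\<^sub>F at_right (0::real)"
  obtain U L where U: "open U" "z \<in> U" and L: "L-lipschitz_on U \<psi>"
    using assms unfolding locally_Lipschitz_def by blast
  have "\<bar>Clarke_dderiv \<psi> z w\<bar> \<le> ereal (L * norm w)" for w
  proof -
    have "\<forall>\<^sub>F u in nhds z. u \<in> U" using U by (rule eventually_nhds_in_open)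
    hence 1: "\<forall>\<^sub>F x in ?F. fst x \<in> U"
      using eventually_prod1[of "at_right (0::real)" "\<lambda>u. u \<in> U" "nhds z"]
      by (simp add: case_prod_unfold)
    have 2: "\<forall>\<^sub>F x in ?F. fst x + snd x *\<^sub>R w \<in> U"
      using eventually_compose_filterlim[OF 1 filterlim_Clarke_shift[of 1 w z]]
      by (simp add: case_prod_unfold)
    have *: "\<forall>\<^sub>F (u, t) in ?F. \<bar>(\<psi> (u + t *\<^sub>R w) - \<psi> u) / t\<bar> \<le> L * norm w"
      using 1 2 eventually_Clarke_filter_pos
    proof eventually_elim
      case (elim x)
      have "\<bar>\<psi> (fst x + snd x *\<^sub>R w) - \<psi> (fst x)\<bar> \<le> L * norm (snd x *\<^sub>R w)"
        using lipschitz_on_normD[OF L elim(2,1)] by simp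
      thus ?case using elim(3) by (simp add: case_prod_unfold field_simps)
    qed
    have "Clarke_dderiv \<psi> z w \<le> ereal (L * norm w)"
      by (rule Clarke_dderiv_le) (use * in eventually_elim, auto simp: abs_le_iff simp del: abs_divide)
    moreover have "ereal (- (L * norm w)) \<le> Clarke_dderiv \<psi> z w"
      unfolding Clarke_dderiv_def
      by (rule le_Limsup[OF Clarke_filter_not_bot]) (use * in eventually_elim, auto simp: abs_le_iff simp del: abs_divide)
    ultimately show ?thesis
      by (cases "Clarke_dderiv \<psi> z w") auto
  qed
  thus thesis using that by blast
qed

lemma Clarke_dderiv_eq_ereal:
  assumes "locally_Lipschitz \<psi>"
  shows "Clarke_dderiv \<psi> z w = ereal (real_of_ereal (Clarke_dderiv \<psi> z w))"
proof -
  obtain L where "\<bar>Clarke_dderiv \<psi> z w\<bar> \<le> ereal (L * norm w)"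
    using Clarke_dderiv_bound[OF assms] by blast
  thus ?thesis by (cases "Clarke_dderiv \<psi> z w") auto
qed

text \<open>The difference quotient along \<open>v + w\<close> splits at the intermediate point
  \<open>u + t *\<^sub>R v\<close>, which is itself an admissible base point.\<close>

lemma Clarke_dderiv_add:
  assumes "locally_Lipschitz \<psi>"
  shows "Clarke_dderiv \<psi> z (v + w) \<le> Clarke_dderiv \<psi> z v + Clarke_dderiv \<psi> z w"
proof -
  obtain p q where p: "Clarke_dderiv \<psi> z v = ereal p" and q: "Clarke_dderiv \<psi> z w = ereal q"
    using Clarke_dderiv_eq_ereal[OF assms] by blast
  have "Clarke_dderiv \<psi> z (v + w) \<le> ereal (p + q + e)" if "e > 0" for e
  proof (rule Clarke_dderiv_le)
    let ?F = "nhds z \<times>\<^sub>F at_right (0::real)"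
    have "\<forall>\<^sub>F (u, t) in ?F. (\<psi> (u + t *\<^sub>R v) - \<psi> u) / t < p + e / 2"
      using that by (intro Clarke_dderiv_lessD) (simp add: p)
    moreover have "\<forall>\<^sub>F (u, t) in ?F. (\<psi> (u + t *\<^sub>R w) - \<psi> u) / t < q + e / 2"
      using that by (intro Clarke_dderiv_lessD) (simp add: q)
    from eventually_compose_filterlim[OF this filterlim_Clarke_shift[of 1 v z]]
    have "\<forall>\<^sub>F (u, t) in ?F. (\<psi> (u + t *\<^sub>R v + t *\<^sub>R w) - \<psi> (u + t *\<^sub>R v)) / t < q + e / 2"
      by (simp add: case_prod_unfold)
    ultimately show "\<forall>\<^sub>F (u, t) in ?F. (\<psi> (u + t *\<^sub>R (v + w)) - \<psi> u) / t \<le> p + q + e"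
      by eventually_elim (auto simp: algebra_simps diff_divide_distrib)
  qed
  thus ?thesis
    using ereal_le_epsilon2[of _ "ereal (p + q)"] by (simp add: p q)
qed

lemma Clarke_dderiv_scale_le:
  assumes "locally_Lipschitz \<psi>" "s > 0"
  shows "Clarke_dderiv \<psi> z (s *\<^sub>R w) \<le> ereal s * Clarke_dderiv \<psi> z w"
proof -
  obtain p where p: "Clarke_dderiv \<psi> z w = ereal p"
    using Clarke_dderiv_eq_ereal[OF assms(1)] by blast
  have "Clarke_dderiv \<psi> z (s *\<^sub>R w) \<le> ereal (s * p + e)" if "e > 0" for e
  proof (rule Clarke_dderiv_le)
    let ?F = "nhds z \<times>\<^sub>F at_right (0::real)"
    \<comment> \<open>The slack is \<open>e / s\<close> because replacing the step \<open>t\<close>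
      by \<open>s * t\<close> multiplies the quotient by \<open>s\<close>.\<close>
    have "\<forall>\<^sub>F (u, t) in ?F. (\<psi> (u + t *\<^sub>R w) - \<psi> u) / t < p + e / s"
      using that assms(2) by (intro Clarke_dderiv_lessD) (simp add: p)
    from eventually_compose_filterlim[OF this filterlim_Clarke_shift[OF assms(2), of 0 z]]
    show "\<forall>\<^sub>F (u, t) in ?F. (\<psi> (u + t *\<^sub>R s *\<^sub>R w) - \<psi> u) / t \<le> s * p + e"
      using eventually_Clarke_filter_pos
    proof eventually_elim
      case (elim x)
      obtain u t where [simp]: "x = (u, t)" by fastforce
      have "(\<psi> (u + (s * t) *\<^sub>R w) - \<psi> u) / t < s * (p + e / s)"
        using elim assms(2) by (simp add: field_simps)
      thus ?case using assms(2) by (simp add: algebra_simps)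
    qed
  qed
  thus ?thesis
    using ereal_le_epsilon2[of _ "ereal (s * p)"] by (simp add: p)
qed

text \<open>The missing inequality is the known one for the factor \<open>1 / s\<close> and the
  direction \<open>s *\<^sub>R w\<close>.\<close>

lemma Clarke_dderiv_scale:
  assumes "locally_Lipschitz \<psi>" "s > 0"
  shows "Clarke_dderiv \<psi> z (s *\<^sub>R w) = ereal s * Clarke_dderiv \<psi> z w"
proof -
  obtain p q where p: "Clarke_dderiv \<psi> z w = ereal p" and q: "Clarke_dderiv \<psi> z (s *\<^sub>R w) = ereal q"
    using Clarke_dderiv_eq_ereal[OF assms(1)] by blast
  have "p \<le> 1 / s * q"
    using Clarke_dderiv_scale_le[OF assms(1), of "1 / s" z "s *\<^sub>R w"] assms(2) by (simp add: p q)
  moreover have "q \<le> s * p"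
    using Clarke_dderiv_scale_le[OF assms, of z w] by (simp add: p q)
  ultimately show ?thesis using assms(2) by (simp add: p q field_simps)
qed

section \<open>The Clarke gradient as a compact convex set, and descent directions\<close>

text \<open>With the inequality built into the definition of the gradient, this makes the
  directional derivative its support function.\<close>

lemma Clarke_gradient_support:
  fixes \<psi> :: "'a::euclidean_space \<Rightarrow> real"
  assumes "locally_Lipschitz \<psi>" "ereal r < Clarke_dderiv \<psi> z w"
  shows "\<exists>v\<in>Clarke_gradient \<psi> z. r < v \<bullet> w"
proof -
  define p where "p w = real_of_ereal (Clarke_dderiv \<psi> z w)" for w
  have p: "Clarke_dderiv \<psi> z w = ereal (p w)" for w
    using Clarke_dderiv_eq_ereal[OF assms(1)] by (simp add: p_def)
  have "\<exists>v. (\<forall>w. v \<bullet> w \<le> p w) \<and> r < v \<bullet> w"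
  proof (rule sublinear_dominated_linear)
    show "p (x + y) \<le> p x + p y" for x y
      using Clarke_dderiv_add[OF assms(1), of z x y] by (simp add: p)
    show "p (s *\<^sub>R x) = s * p x" if "s > 0" for s x
      using Clarke_dderiv_scale[OF assms(1) that, of z x] by (simp add: p)
    show "r < p w" using assms(2) by (simp add: p)
  qed
  thus ?thesis by (auto simp: Clarke_gradient_def p)
qed

lemma Clarke_gradient_nonempty:
  fixes \<psi> :: "'a::euclidean_space \<Rightarrow> real"
  assumes "locally_Lipschitz \<psi>"
  shows "Clarke_gradient \<psi> z \<noteq> {}"
proof -
  obtain p where "Clarke_dderiv \<psi> z 0 = ereal p"
    using Clarke_dderiv_eq_ereal[OF assms] by blast
  thus ?thesis using Clarke_gradient_support[OF assms, of "p - 1" z 0] by auto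
qed

lemma convex_Clarke_gradient: "convex (Clarke_gradient \<psi> z)"
proof -
  have "Clarke_gradient \<psi> z = (\<Inter>w. {v. ereal (v \<bullet> w) \<le> Clarke_dderiv \<psi> z w})"
    by (auto simp: Clarke_gradient_def)
  moreover have "convex {v. ereal (v \<bullet> w) \<le> c}" for w :: 'a and c
    using convex_halfspace_le[of w] by (cases c) (auto simp: inner_commute)
  ultimately show ?thesis by (simp add: convex_INT)
qed

text \<open>The set is an intersection of closed half-spaces; testing \<open>v\<close> in the
  direction \<open>v\<close> itself gives the bound \<open>norm v \<le> L\<close>.\<close>

lemma compact_Clarke_gradient:
  fixes \<psi> :: "'a::euclidean_space \<Rightarrow> real"
  assumes "locally_Lipschitz \<psi>"
  shows "compact (Clarke_gradient \<psi> z)"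
proof -
  have "Clarke_gradient \<psi> z = (\<Inter>w. {v. ereal (v \<bullet> w) \<le> Clarke_dderiv \<psi> z w})"
    by (auto simp: Clarke_gradient_def)
  moreover have "closed {v. ereal (v \<bullet> w) \<le> c}" for w :: 'a and c
    using closed_halfspace_le[of w] by (cases c) (auto simp: inner_commute)
  ultimately have "closed (Clarke_gradient \<psi> z)" by auto
  moreover obtain L where L: "\<And>w. \<bar>Clarke_dderiv \<psi> z w\<bar> \<le> ereal (L * norm w)"
    using Clarke_dderiv_bound[OF assms] by blast
  have "norm v \<le> L" if "v \<in> Clarke_gradient \<psi> z" for v
  proof (cases "v = 0")
    case True
    \<comment> \<open>For \<open>v = 0\<close> the claim is \<open>0 \<le> L\<close>, which is read
      off from a direction of norm one.\<close>
    have "\<bar>Clarke_dderiv \<psi> z (SOME b. b \<in> Basis)\<bar> \<le> ereal (L * 1)"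
      using L[of "SOME b. b \<in> Basis"] by (simp add: SOME_Basis)
    hence "ereal 0 \<le> ereal (L * 1)" using abs_ereal_ge0 order_trans
      by (metis abs_ereal_pos zero_ereal_def)
    thus ?thesis using True by simp
  next
    case False
    have "ereal (v \<bullet> v) \<le> \<bar>Clarke_dderiv \<psi> z v\<bar>"
      using that by (cases "Clarke_dderiv \<psi> z v") (auto simp: Clarke_gradient_def dest: spec[of _ v])
    also note L[of v]
    finally show ?thesis using False by (simp add: dot_square_norm power2_eq_square)
  qed
  hence "bounded (Clarke_gradient \<psi> z)" by (auto simp: bounded_iff)
  ultimately show ?thesis by (simp add: compact_eq_bounded_closed)
qed

text \<open>The support property turns a bound on the gradient into one on the directional
  derivative. As \<open>nhds x\<close> is not punctured, the base point may then be fixed at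
  \<open>x\<close>.\<close>

lemma Clarke_gradient_descent:
  fixes \<psi> :: "'a::euclidean_space \<Rightarrow> real"
  assumes "locally_Lipschitz \<psi>" "\<And>v. v \<in> Clarke_gradient \<psi> x \<Longrightarrow> v \<bullet> w \<le> r" "r < s"
  shows "\<forall>\<^sub>F t in at_right 0. \<psi> (x + t *\<^sub>R w) < \<psi> x + s * t"
proof -
  have "Clarke_dderiv \<psi> x w \<le> ereal r"
    using Clarke_gradient_support[OF assms(1), of r x w] assms(2) by force
  also have "\<dots> < ereal s" using assms(3) by simp
  finally have "\<forall>\<^sub>F (u, t) in nhds x \<times>\<^sub>F at_right 0. (\<psi> (u + t *\<^sub>R w) - \<psi> u) / t < s"
    by (rule Clarke_dderiv_lessD)
  then obtain P Q where P: "\<forall>\<^sub>F u in nhds x. P u" and Q: "\<forall>\<^sub>F t in at_right 0. Q t"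
    and PQ: "\<And>u t. P u \<Longrightarrow> Q t \<Longrightarrow> (\<psi> (u + t *\<^sub>R w) - \<psi> u) / t < s"
    by (auto simp: eventually_prod_filter)
  have "P x" using P by (rule eventually_nhds_x_imp_x)
  show ?thesis
    using Q eventually_at_right_less[of 0]
    by eventually_elim (use PQ[OF \<open>P x\<close>] in \<open>fastforce simp: field_simps\<close>)
qed


section \<open>An abstract multiplier rule\<close>

text \<open>\<open>D i\<close> plays the gradient of \<open>h i\<close> at \<open>x\<close>, but
  only its descent property enters. This leaves room for gradient sets enlarged by a ball, as a norm
  penalty requires.\<close>

lemma convex_hull_multipliers:
  fixes D :: "'i \<Rightarrow> 'a::euclidean_space set"
  assumes fin: "finite A"
    and D: "\<And>i. i \<in> A \<Longrightarrow> compact (D i) \<and> convex (D i) \<and> D i \<noteq> {}"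
    and descent: "\<And>i w r. i \<in> A \<Longrightarrow> r > 0 \<Longrightarrow> (\<And>v. v \<in> D i \<Longrightarrow> v \<bullet> w \<le> - r) \<Longrightarrow>
      \<forall>\<^sub>F t in at_right 0. h i (x + t *\<^sub>R w) < (0::real)"
    and nonneg: "\<forall>\<^sub>F z in nhds x. \<exists>i\<in>A. h i z \<ge> 0"
  shows "\<exists>t s. (\<forall>i\<in>A. t i \<ge> 0) \<and> sum t A = 1 \<and> (\<forall>i\<in>A. s i \<in> D i) \<and>
    (\<Sum>i\<in>A. t i *\<^sub>R s i) = 0"
proof -
  define C where "C = convex hull (\<Union>(D ` A))"
  have "A \<noteq> {}"
    using eventually_nhds_x_imp_x[OF nonneg] by auto
  have "0 \<in> C"
  \<comment> \<open>Otherwise \<open>- v\<close>, for \<open>v\<close> the point of \<open>C\<close> closest to \<open>0\<close>, is a common descent direction.\<close>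
  proof (rule ccontr)
    assume "0 \<notin> C"
    have "compact C"
      unfolding C_def using fin D by (intro compact_convex_hull compact_UN) auto
    hence "closed C" by (rule compact_imp_closed)
    have convex_C: "convex C" by (simp add: C_def)
    have "C \<noteq> {}" using \<open>A \<noteq> {}\<close> D by (auto simp: C_def)
    define v where "v = closest_point C 0"
    have "v \<in> C" using \<open>closed C\<close> \<open>C \<noteq> {}\<close> by (simp add: v_def closest_point_in_set)
    hence "v \<noteq> 0" using \<open>0 \<notin> C\<close> by auto
    \<comment> \<open>This is the variational inequality of the projection of \<open>0\<close> onto
      \<open>C\<close>; it makes the descent rate uniform over all \<open>D i\<close>.\<close>
    have C: "u \<bullet> (- v) \<le> - (v \<bullet> v)" if "u \<in> C" for u
      using closest_point_dot[OF _ \<open>closed C\<close> that, of 0]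
      by (simp add: v_def[symmetric] inner_diff_right inner_commute convex_C)
    have "\<forall>\<^sub>F t in at_right 0. \<forall>i\<in>A. h i (x + t *\<^sub>R (- v)) < 0"
    proof (intro eventually_ball_finite fin ballI descent)
      show "v \<bullet> v > 0" using \<open>v \<noteq> 0\<close> by simp
      show "u \<bullet> (- v) \<le> - (v \<bullet> v)" if "i \<in> A" "u \<in> D i" for i u
        using that by (intro C) (auto simp: C_def intro: hull_inc)
    qed
    moreover have "((\<lambda>t. x + t *\<^sub>R (- v)) \<longlongrightarrow> x + 0 *\<^sub>R (- v)) (at_right 0)"
      by (intro tendsto_intros)
    hence "\<forall>\<^sub>F t in at_right 0. \<exists>i\<in>A. h i (x + t *\<^sub>R (- v)) \<ge> 0"
      using eventually_compose_filterlim[OF nonneg] by simp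
    ultimately have "\<forall>\<^sub>F t in at_right (0::real). False"
      by eventually_elim force
    thus False by simp
  qed
  \<comment> \<open>For convex nonempty sets, a point of the hull of the union is a convex
    combination with a single point from each set.\<close>
  moreover have "\<forall>i\<in>A. convex (D i) \<and> D i \<noteq> {}" using D by blast
  ultimately show ?thesis
    unfolding C_def by (simp add: convex_hull_finite_union[OF fin]) metis
qed

section \<open>Continuity and interval-valued functions\<close>

lemma continuous_on_Max:
  fixes f :: "'i \<Rightarrow> 'a::topological_space \<Rightarrow> 'b::linorder_topology"
  assumes "finite I" "I \<noteq> {}" "\<And>i. i \<in> I \<Longrightarrow> continuous_on S (f i)"
  shows "continuous_on S (\<lambda>x. MAX i\<in>I. f i x)"
  using assms
proof (induction rule: finite_ne_induct)
  case (insert i I)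
  thus ?case by (simp add: continuous_on_max)
qed simp

lemma locally_Lipschitz_continuous:
  assumes "locally_Lipschitz \<psi>"
  shows "continuous_on S \<psi>"
proof -
  have "isCont \<psi> x" for x
  proof -
    obtain U L where "open U" "x \<in> U" "L-lipschitz_on U \<psi>"
      using assms unfolding locally_Lipschitz_def by blast
    thus ?thesis
      using lipschitz_on_continuous_on continuous_on_eq_continuous_at by blast
  qed
  thus ?thesis by (simp add: continuous_at_imp_continuous_on)
qed

lemma
  assumes "locally_Lipschitz_ivl f"
  shows locally_Lipschitz_center: "locally_Lipschitz (\<lambda>v. center (f v))"
    and locally_Lipschitz_half_width: "locally_Lipschitz (\<lambda>v. half_width (f v))"
proof -
  have "\<exists>U L. open U \<and> x \<in> U \<and> L > 0 \<and> L-lipschitz_on U (\<lambda>v. center (f v)) \<and>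
    L-lipschitz_on U (\<lambda>v. half_width (f v))" for x
  proof -
    obtain U L where U: "open U" "x \<in> U" "L > 0" and L: "\<forall>u\<in>U. \<forall>v\<in>U.
        max \<bar>lower (f u) - lower (f v)\<bar> \<bar>upper (f u) - upper (f v)\<bar> \<le> L * norm (u - v)"
      using spec[OF assms[unfolded locally_Lipschitz_ivl_def], of x] by (elim exE conjE) (rule that)
    have "\<bar>center (f u) - center (f v)\<bar> \<le> L * norm (u - v) \<and>
      \<bar>half_width (f u) - half_width (f v)\<bar> \<le> L * norm (u - v)" if "u \<in> U" "v \<in> U" for u v
    proof -
      have "\<bar>lower (f u) - lower (f v)\<bar> \<le> L * norm (u - v)"
        "\<bar>upper (f u) - upper (f v)\<bar> \<le> L * norm (u - v)"
        using L that by simp_all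
      thus ?thesis
        by (simp add: center_def half_width_def abs_le_iff field_simps)
    qed
    thus ?thesis using U by (intro exI[of _ U] exI[of _ L]) (auto simp: lipschitz_on_def dist_norm)
  qed
  thus "locally_Lipschitz (\<lambda>v. center (f v))" "locally_Lipschitz (\<lambda>v. half_width (f v))"
    unfolding locally_Lipschitz_def by meson+
qed

text \<open>The interval from \<open>0\<close> to \<open>e\<close> has center and half-width both
  equal to \<open>e / 2\<close>, so one and the same shift appears in the two components of the
  order.\<close>

lemma
  assumes "e \<ge> 0"
  shows center_plus_Interval: "center (Q + Interval (0, e)) = center Q + e / 2"
    and half_width_plus_Interval: "half_width (Q + Interval (0, e)) = half_width Q + e / 2"
proof -
  have "lower (Interval (0, e)) = 0" "upper (Interval (0, e)) = e"
    using assms by (simp_all add: lower.rep_eq upper.rep_eq Interval_inverse)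
  thus "center (Q + Interval (0, e)) = center Q + e / 2"
    "half_width (Q + Interval (0, e)) = half_width Q + e / 2"
    by (simp_all add: center_def half_width_def field_simps)
qed

lemma
  fixes f :: "'a::euclidean_space \<Rightarrow> real interval"
  assumes "locally_Lipschitz_ivl f"
  shows compact_weak_gradient: "compact (weak_gradient f x)"
    and weak_gradient_nonempty: "weak_gradient f x \<noteq> {}"
proof -
  note c = locally_Lipschitz_center[OF assms] and w = locally_Lipschitz_half_width[OF assms]
  show "compact (weak_gradient f x)"
    unfolding weak_gradient_def
    by (intro compact_convex_hull compact_Un compact_Clarke_gradient c w)
  show "weak_gradient f x \<noteq> {}"
    unfolding weak_gradient_def using Clarke_gradient_nonempty[OF c, of x] by simp
qed

lemma convex_weak_gradient: "convex (weak_gradient f x)"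
  by (simp add: weak_gradient_def)

section \<open>A Fritz John condition for the penalized problem\<close>

text \<open>The abstract rule is applied to objectives and active constraints together. Center and
  half-width share one multiplier, since the weak gradient is the hull of both gradients. Each
  objective brings its own ball of radius \<open>c\<close>, so the residual is bounded by
  \<open>c * sum lam K\<close>: it vanishes with the objective multipliers, and it scales when they
  are normalized.\<close>

lemma Fritz_John_penalized:
  fixes F :: "'k \<Rightarrow> 'a::euclidean_space \<Rightarrow> real interval" and g :: "nat \<Rightarrow> 'a \<Rightarrow> real"
  assumes fin: "finite K" "finite J"
    and F: "\<And>k. k \<in> K \<Longrightarrow> locally_Lipschitz_ivl (F k)"
    and g: "\<And>j. j \<in> J \<Longrightarrow> locally_Lipschitz (g j)"
    and x: "x \<in> feasible_set J g" and c: "c \<ge> 0"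
    and at_x: "\<And>k. k \<in> K \<Longrightarrow> center (F k x) \<le> \<alpha> k \<and> half_width (F k x) \<le> \<beta> k"
    and minimal: "\<And>z. z \<in> feasible_set J g \<Longrightarrow> \<exists>k\<in>K. \<alpha> k \<le> center (F k z) + c * norm (z - x) \<or>
      \<beta> k \<le> half_width (F k z) + c * norm (z - x)"
  obtains lam \<mu> \<xi> \<zeta> where
    "\<And>k. k \<in> K \<Longrightarrow> lam k \<ge> 0" "\<And>j. j \<in> active J g x \<Longrightarrow> \<mu> j \<ge> 0"
    "sum lam K + sum \<mu> (active J g x) = 1"
    "\<And>k. k \<in> K \<Longrightarrow> \<xi> k \<in> weak_gradient (F k) x"
    "\<And>j. j \<in> active J g x \<Longrightarrow> \<zeta> j \<in> Clarke_gradient (g j) x"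
    "norm ((\<Sum>k\<in>K. lam k *\<^sub>R \<xi> k) + (\<Sum>j\<in>active J g x. \<mu> j *\<^sub>R \<zeta> j)) \<le> c * sum lam K"
proof -
  let ?A = "K <+> active J g x"
  define D where "D = case_sum (\<lambda>k. weak_gradient (F k) x + cball 0 c) (\<lambda>j. Clarke_gradient (g j) x)"
  \<comment> \<open>The penalty is attached to the objectives only; \<open>at_x\<close> makes these
    functions nonpositive at \<open>x\<close>, and \<open>minimal\<close> makes one of them
    nonnegative at each feasible point.\<close>
  define h where "h = case_sum
    (\<lambda>k z. max (center (F k z) - \<alpha> k) (half_width (F k z) - \<beta> k) + c * norm (z - x)) g"
  have fin': "finite (active J g x)" using fin by (simp add: active_def)
  have "\<exists>t s. (\<forall>i\<in>?A. t i \<ge> 0) \<and> sum t ?A = 1 \<and> (\<forall>i\<in>?A. s i \<in> D i) \<and>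
    (\<Sum>i\<in>?A. t i *\<^sub>R s i) = 0"
  proof (rule convex_hull_multipliers[of ?A D h x])
    show "finite ?A" using fin(1) fin' by simp
    show "compact (D i) \<and> convex (D i) \<and> D i \<noteq> {}" if "i \<in> ?A" for i
    proof (cases i)
      case (Inl k)
      hence "locally_Lipschitz_ivl (F k)" using that F by auto
      note * = compact_weak_gradient[OF this, of x] weak_gradient_nonempty[OF this, of x]
      have "weak_gradient (F k) x + cball 0 c = {a + b | a b. a \<in> weak_gradient (F k) x \<and> b \<in> cball 0 c}"
        unfolding set_plus_def by blast
      moreover have "compact \<dots>" using * by (intro compact_sums) auto
      moreover obtain a where "a \<in> weak_gradient (F k) x" using * by blast
      hence "a + 0 \<in> weak_gradient (F k) x + cball 0 c"
        using c by (intro set_plus_intro) auto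
      moreover have "convex (weak_gradient (F k) x + cball 0 c)"
        by (intro convex_set_plus convex_weak_gradient convex_cball)
      ultimately show ?thesis by (auto simp: D_def Inl)
    next
      case (Inr j)
      hence "locally_Lipschitz (g j)" using that g by (auto simp: active_def)
      thus ?thesis
        by (simp add: D_def Inr compact_Clarke_gradient convex_Clarke_gradient Clarke_gradient_nonempty)
    qed
    show "\<forall>\<^sub>F t in at_right 0. h i (x + t *\<^sub>R w) < 0"
      if i: "i \<in> ?A" and "r > 0" and D: "\<And>v. v \<in> D i \<Longrightarrow> v \<bullet> w \<le> - r" for i w r
    proof (cases i)
      case (Inl k)
      hence k: "k \<in> K" using i by auto
      have weak: "v \<bullet> w \<le> - r - c * norm w" if "v \<in> weak_gradient (F k) x" for v
      proof -
        \<comment> \<open>The worst element of the ball absorbs the growth of the penalty along \<open>w\<close>.\<close>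
        have "norm (c *\<^sub>R sgn w) \<le> c" using c by (simp add: norm_sgn)
        hence "v + c *\<^sub>R sgn w \<in> D i" using that by (auto simp: D_def Inl)
        from D[OF this] have "v \<bullet> w + c * (sgn w \<bullet> w) \<le> - r" by (simp add: inner_add_left)
        moreover have "sgn w \<bullet> w = norm w"
          by (cases "w = 0") (simp_all add: sgn_div_norm dot_square_norm power2_eq_square)
        ultimately show ?thesis by simp
      qed
      \<comment> \<open>Half of \<open>r\<close> is spent on the strict gap that the descent lemma
        demands; the other half remains as decrease once the penalty has cancelled
        \<open>c * norm w\<close>.\<close>
      have s: "- r - c * norm w < - r / 2 - c * norm w" using \<open>r > 0\<close> by simp
      have "\<forall>\<^sub>F t in at_right 0.
          center (F k (x + t *\<^sub>R w)) < center (F k x) + (- r / 2 - c * norm w) * t"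
        by (rule Clarke_gradient_descent[OF locally_Lipschitz_center[OF F[OF k]] weak s])
          (auto simp: weak_gradient_def intro: hull_inc)
      moreover have "\<forall>\<^sub>F t in at_right 0.
          half_width (F k (x + t *\<^sub>R w)) < half_width (F k x) + (- r / 2 - c * norm w) * t"
        by (rule Clarke_gradient_descent[OF locally_Lipschitz_half_width[OF F[OF k]] weak s])
          (auto simp: weak_gradient_def intro: hull_inc)
      ultimately show ?thesis
        using eventually_at_right_less[of 0]
      proof eventually_elim
        case (elim t)
        have "r / 2 * t > 0" using \<open>r > 0\<close> elim(3) by simp
        moreover have "norm (t *\<^sub>R w) = t * norm w" using elim(3) by simp
        ultimately show ?case
          using elim(1,2) at_x[OF k] by (auto simp: h_def Inl algebra_simps)
      qed
    next
      case (Inr j)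
      hence j: "locally_Lipschitz (g j)" "g j x = 0" using i g by (auto simp: active_def)
      have "\<forall>\<^sub>F t in at_right 0. g j (x + t *\<^sub>R w) < g j x + 0 * t"
        by (rule Clarke_gradient_descent[OF j(1), of _ _ "- r"])
          (use \<open>r > 0\<close> D in \<open>auto simp: D_def Inr\<close>)
      thus ?thesis by (simp add: h_def Inr j(2))
    qed
    \<comment> \<open>Inactive constraints stay negative near \<open>x\<close> by continuity, so an
      infeasible point nearby violates an active one.\<close>
    have "\<forall>\<^sub>F z in nhds x. \<forall>j\<in>J - active J g x. g j z < 0"
    proof (intro eventually_ball_finite ballI)
      fix j assume j: "j \<in> J - active J g x"
      hence "g j x < 0" using x by (force simp: active_def feasible_set_def)
      moreover have "isCont (g j) x"
        using locally_Lipschitz_continuous[OF g, of j UNIV] j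
        by (simp add: continuous_on_eq_continuous_at)
      ultimately show "\<forall>\<^sub>F z in nhds x. g j z < 0"
        by (intro order_tendstoD(2)[of _ "g j x"]) (simp_all add: isCont_def tendsto_at_iff_tendsto_nhds)
    qed (use fin in auto)
    thus "\<forall>\<^sub>F z in nhds x. \<exists>i\<in>?A. h i z \<ge> 0"
    proof eventually_elim
      case (elim z)
      show ?case
      proof (cases "z \<in> feasible_set J g")
        case True
        then obtain k where "k \<in> K" "\<alpha> k \<le> center (F k z) + c * norm (z - x) \<or>
            \<beta> k \<le> half_width (F k z) + c * norm (z - x)"
          using minimal by blast
        thus ?thesis by (intro bexI[of _ "Inl k"]) (auto simp: h_def)
      next
        case False
        then obtain j where "j \<in> J" "g j z > 0" by (auto simp: feasible_set_def not_le)
        thus ?thesis using elim by (intro bexI[of _ "Inr j"]) (force simp: h_def)+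
      qed
    qed
  qed
  then obtain t s where t: "\<And>i. i \<in> ?A \<Longrightarrow> t i \<ge> 0" "sum t ?A = 1"
    and s: "\<And>i. i \<in> ?A \<Longrightarrow> s i \<in> D i" and ts: "(\<Sum>i\<in>?A. t i *\<^sub>R s i) = 0"
    by (elim exE conjE) (rule that; (assumption | erule (1) bspec))
  have "\<exists>a b. a \<in> weak_gradient (F k) x \<and> norm b \<le> c \<and> s (Inl k) = a + b" if "k \<in> K" for k
    using s[OF InlI[OF that]] by (fastforce simp: D_def set_plus_def)
  then obtain \<xi> b where \<xi>: "\<And>k. k \<in> K \<Longrightarrow> \<xi> k \<in> weak_gradient (F k) x"
    and b: "\<And>k. k \<in> K \<Longrightarrow> norm (b k) \<le> c" and sb: "\<And>k. k \<in> K \<Longrightarrow> s (Inl k) = \<xi> k + b k"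
    by metis
  have "0 = (\<Sum>k\<in>K. t (Inl k) *\<^sub>R (\<xi> k + b k)) + (\<Sum>j\<in>active J g x. t (Inr j) *\<^sub>R s (Inr j))"
    using ts fin(1) fin' by (simp add: sum.Plus sb)
  hence "(\<Sum>k\<in>K. t (Inl k) *\<^sub>R \<xi> k) + (\<Sum>j\<in>active J g x. t (Inr j) *\<^sub>R s (Inr j)) =
      - (\<Sum>k\<in>K. t (Inl k) *\<^sub>R b k)"
    by (simp add: scaleR_add_right sum.distrib eq_neg_iff_add_eq_0 algebra_simps)
  moreover have "norm (- (\<Sum>k\<in>K. t (Inl k) *\<^sub>R b k)) \<le> (\<Sum>k\<in>K. t (Inl k) * c)"
    unfolding norm_minus_cancel
    by (rule sum_norm_le) (use t(1)[OF InlI] b in \<open>simp add: mult_left_mono\<close>)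
  moreover have "s (Inr j) \<in> Clarke_gradient (g j) x" if "j \<in> active J g x" for j
    using s[OF InrI[OF that]] by (simp add: D_def)
  ultimately show thesis
    using t \<xi> fin(1) fin'
    by (intro that[of "\<lambda>k. t (Inl k)" "\<lambda>j. t (Inr j)" \<xi> "\<lambda>j. s (Inr j)"])
      (auto simp: sum.Plus sum_distrib_left mult.commute)
qed

section \<open>From an approximate solution to a penalized minimizer\<close>

text \<open>The thresholds \<open>\<alpha> k\<close> and \<open>\<beta> k\<close> are the values of
  center and half-width at which the corresponding term of \<open>\<phi> k\<close> equals
  \<open>\<Phi> x\<close>. They state minimality of the maximum componentwise, as the multiplier
  rule expects it.\<close>

lemma approx_solution_penalized_minimizer:
  fixes F :: "nat \<Rightarrow> 'a::euclidean_space \<Rightarrow> real interval"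
  assumes K: "finite K" "K \<noteq> {}"
    and F: "\<And>k. k \<in> K \<Longrightarrow> locally_Lipschitz_ivl (F k)"
    and eps: "\<And>k. k \<in> K \<Longrightarrow> \<epsilon> k \<ge> 0" and e: "(MAX k\<in>K. \<epsilon> k) > 0"
    and S: "closed S" and u: "u \<in> approx_solutions K F S \<epsilon>" and \<delta>: "\<delta> > 0"
  defines "c \<equiv> (MAX k\<in>K. \<epsilon> k) / (2 * \<delta>)"
  obtains x \<alpha> \<beta> where "x \<in> S" "norm (x - u) \<le> \<delta>"
    "\<And>k. k \<in> K \<Longrightarrow> center (F k x) \<le> \<alpha> k \<and> half_width (F k x) \<le> \<beta> k"
    "\<And>z. z \<in> S \<Longrightarrow> \<exists>k\<in>K. \<alpha> k \<le> center (F k z) + c * norm (z - x) \<or>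
      \<beta> k \<le> half_width (F k z) + c * norm (z - x)"
proof -
  define E where "E = (MAX k\<in>K. \<epsilon> k)"
  have "E > 0" using e by (simp add: E_def)
  have c: "c * \<delta> = E / 2" "c > 0" using \<delta> \<open>E > 0\<close> by (simp_all add: c_def E_def)
  define \<phi> where "\<phi> k z = max (center (F k z) - center (F k u)) (half_width (F k z) - half_width (F k u))
    + \<epsilon> k / 2" for k z
  define \<Phi> where "\<Phi> z = (MAX k\<in>K. \<phi> k z)" for z
  have "u \<in> S" using u by (simp add: approx_solutions_def)
  have cont: "continuous_on T \<Phi>" for T
    unfolding \<Phi>_def \<phi>_def
    by (intro continuous_on_Max K continuous_intros locally_Lipschitz_continuous
        locally_Lipschitz_center locally_Lipschitz_half_width F)
  have \<Phi>_ge: "\<phi> k z \<le> \<Phi> z" if "k \<in> K" for k z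
    using K that by (simp add: \<Phi>_def)
  have \<Phi>_attained: "\<exists>k\<in>K. \<Phi> z = \<phi> k z" for z
  proof -
    have "\<Phi> z \<in> (\<lambda>k. \<phi> k z) ` K" unfolding \<Phi>_def using K by (intro Max_in) auto
    thus ?thesis by auto
  qed
  \<comment> \<open>If the strict order fails for \<open>k\<close>, then center or half-width of
    \<open>F k z\<close>, raised by \<open>\<epsilon> k / 2\<close>, is at least that of
    \<open>F k u\<close>; this is a nonnegative term of \<open>\<phi> k z\<close>.\<close>
  have \<Phi>_nonneg: "\<Phi> z \<ge> 0" if z: "z \<in> S" for z
  proof -
    obtain k where k: "k \<in> K" "\<not> F k z + Interval (0, \<epsilon> k) \<prec>\<^sub>C\<^sub>W F k u"
      using u z unfolding approx_solutions_def by blast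
    hence "\<phi> k z \<ge> 0"
      using eps[OF k(1)]
      by (auto simp: \<phi>_def less_CW_def center_plus_Interval half_width_plus_Interval)
    thus ?thesis using \<Phi>_ge[OF k(1), of z] by simp
  qed
  have "\<phi> k u \<le> E / 2" if "k \<in> K" for k
    using K that by (simp add: \<phi>_def E_def)
  hence \<Phi>_u: "\<Phi> u \<le> E / 2" using \<Phi>_attained[of u] by auto
  have "compact (S \<inter> cball u \<delta>)" using S by (simp add: closed_Int_compact)
  moreover have "continuous_on (S \<inter> cball u \<delta>) (\<lambda>z. \<Phi> z + c * norm (z - u))"
    by (intro continuous_intros cont)
  moreover have "u \<in> S \<inter> cball u \<delta>" using \<open>u \<in> S\<close> \<delta> by simp
  ultimately obtain x where x: "x \<in> S \<inter> cball u \<delta>"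
    and min: "\<And>z. z \<in> S \<inter> cball u \<delta> \<Longrightarrow> \<Phi> x + c * norm (x - u) \<le> \<Phi> z + c * norm (z - u)"
    using continuous_attains_inf by (metis (no_types, lifting) empty_iff)
  have glob: "\<Phi> x \<le> \<Phi> z + c * norm (z - x)" if "z \<in> S" for z
  proof -
    have "\<Phi> x + c * norm (x - u) \<le> \<Phi> z + c * norm (z - u)"
    proof (cases "norm (z - u) \<le> \<delta>")
      case True
      thus ?thesis using that by (intro min) (simp add: dist_norm norm_minus_commute)
    next
      \<comment> \<open>Outside the ball the penalty alone exceeds \<open>c * \<delta>\<close>,
        which bounds the penalized value at \<open>u\<close> and hence the minimum.\<close>
      case False
      have "\<Phi> x + c * norm (x - u) \<le> \<Phi> u"
        using min[of u] \<open>u \<in> S\<close> \<delta> by simp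
      also have "\<dots> \<le> c * \<delta>" using \<Phi>_u c by simp
      also have "\<dots> \<le> c * norm (z - u)" using False c by simp
      finally show ?thesis using \<Phi>_nonneg[OF that] by simp
    qed
    \<comment> \<open>The triangle inequality moves the center of the penalty from \<open>u\<close>
      to \<open>x\<close>, where the penalty vanishes.\<close>
    moreover have "c * norm (z - u) \<le> c * (norm (z - x) + norm (x - u))"
      using c norm_triangle_ineq[of "z - x" "x - u"] by (intro mult_left_mono) auto
    ultimately show ?thesis by (simp add: algebra_simps)
  qed
  show thesis
  proof
    show "x \<in> S" "norm (x - u) \<le> \<delta>" using x by (simp_all add: dist_norm norm_minus_commute)
    show "center (F k x) \<le> \<Phi> x - \<epsilon> k / 2 + center (F k u) \<and>
        half_width (F k x) \<le> \<Phi> x - \<epsilon> k / 2 + half_width (F k u)" if "k \<in> K" for k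
      using \<Phi>_ge[OF that, of x] by (auto simp: \<phi>_def)
    show "\<exists>k\<in>K. \<Phi> x - \<epsilon> k / 2 + center (F k u) \<le> center (F k z) + c * norm (z - x) \<or>
        \<Phi> x - \<epsilon> k / 2 + half_width (F k u) \<le> half_width (F k z) + c * norm (z - x)"
      if z: "z \<in> S" for z
    proof -
      obtain k where k: "k \<in> K" "\<Phi> z = \<phi> k z" using \<Phi>_attained by blast
      show ?thesis
        using glob[OF z] k by (intro bexI[of _ k]) (auto simp: \<phi>_def max_def split: if_splits)
    qed
  qed
qed

section \<open>The constraint qualification and the final normalization\<close>

lemma closed_feasible_set:
  fixes g :: "nat \<Rightarrow> 'a::metric_space \<Rightarrow> real"
  assumes "\<And>j. j \<in> J \<Longrightarrow> locally_Lipschitz (g j)"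
  shows "closed (feasible_set J g)"
proof -
  have "feasible_set J g = (\<Inter>j\<in>J. {u. g j u \<le> 0})" by (auto simp: feasible_set_def)
  thus ?thesis
    by (simp add: closed_INT closed_Collect_le[OF locally_Lipschitz_continuous[OF assms] continuous_on_const])
qed

lemma sum_mem_set_sum:
  assumes "finite I" "\<And>i. i \<in> I \<Longrightarrow> s i \<in> A i"
  shows "sum s I \<in> (\<Sum>i\<in>I. A i)"
  unfolding set_sum_alt[OF assms(1)] using assms(2) by blast

text \<open>\<open>BCQ\<close> sums over all of \<open>J\<close>, whereas the multipliers are known
  on the active constraints only; they are extended by zero.\<close>

lemma BCQ_sum_nonzero:
  fixes g :: "nat \<Rightarrow> 'a::euclidean_space \<Rightarrow> real"
  assumes "BCQ J g x" "finite J" and g: "\<And>j. j \<in> J \<Longrightarrow> locally_Lipschitz (g j)"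
    and \<mu>: "\<And>j. j \<in> active J g x \<Longrightarrow> \<mu> j \<ge> 0" "sum \<mu> (active J g x) > 0"
    and \<zeta>: "\<And>j. j \<in> active J g x \<Longrightarrow> \<zeta> j \<in> Clarke_gradient (g j) x"
  shows "(\<Sum>j\<in>active J g x. \<mu> j *\<^sub>R \<zeta> j) \<noteq> 0"
proof
  assume zero: "(\<Sum>j\<in>active J g x. \<mu> j *\<^sub>R \<zeta> j) = 0"
  define \<nu> where "\<nu> j = (if j \<in> active J g x then \<mu> j else 0)" for j
  \<comment> \<open>Even with multiplier zero, an inactive constraint must supply an element of its
    gradient to the Minkowski sum; nonemptiness provides one.\<close>
  define \<eta> where "\<eta> j = (if j \<in> active J g x then \<zeta> j else SOME v. v \<in> Clarke_gradient (g j) x)" for j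
  have sub: "active J g x \<subseteq> J" by (auto simp: active_def)
  have \<eta>: "\<eta> j \<in> Clarke_gradient (g j) x" if "j \<in> J" for j
    using \<zeta> Clarke_gradient_nonempty[OF g[OF that], of x]
    by (auto simp: \<eta>_def some_in_eq)
  have "(\<Sum>j\<in>J. \<nu> j *\<^sub>R \<eta> j) = (\<Sum>j\<in>active J g x. \<mu> j *\<^sub>R \<zeta> j)"
    using assms(2) sub by (intro sum.mono_neutral_cong_right) (auto simp: \<nu>_def \<eta>_def)
  moreover have "(\<Sum>j\<in>J. \<nu> j *\<^sub>R \<eta> j) \<in> (\<Sum>j\<in>J. (\<lambda>v. \<nu> j *\<^sub>R v) ` Clarke_gradient (g j) x)"
    using assms(2) \<eta> by (intro sum_mem_set_sum) auto
  ultimately have "0 \<in> (\<Sum>j\<in>J. (\<lambda>v. \<nu> j *\<^sub>R v) ` Clarke_gradient (g j) x)"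
    using zero by simp
  moreover obtain j where "j \<in> active J g x" "\<mu> j \<noteq> 0"
    using \<mu>(2) by (metis less_irrefl sum.neutral)
  hence "\<exists>j\<in>J. \<nu> j \<noteq> 0" using sub by (auto simp: \<nu>_def)
  moreover have "\<forall>j\<in>J. \<nu> j \<ge> 0" "\<forall>j\<in>J - active J g x. \<nu> j = 0"
    using \<mu>(1) by (auto simp: \<nu>_def)
  ultimately show False
    using assms(1) unfolding BCQ_def by blast
qed

theorem theorem4p1:
  fixes F :: "nat \<Rightarrow> real ^ 'n \<Rightarrow> real interval"
    and g :: "nat \<Rightarrow> real ^ 'n \<Rightarrow> real"
    and m p :: nat
    and \<epsilon> :: "nat \<Rightarrow> real"
    and ubar :: "real ^ 'n"
    and \<delta> :: real
  assumes F: "\<And>k. k \<in> {1..m} \<Longrightarrow> locally_Lipschitz_ivl (F k)"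
    and g: "\<And>j. j \<in> {1..p} \<Longrightarrow> locally_Lipschitz (g j)"
    and eps_nonneg: "\<And>k. k \<in> {1..m} \<Longrightarrow> \<epsilon> k \<ge> 0"
    and eps_nonzero: "\<exists>k\<in>{1..m}. \<epsilon> k \<noteq> 0"
    and ubar: "ubar \<in> approx_solutions {1..m} F (feasible_set {1..p} g) \<epsilon>"
    and delta: "\<delta> > 0"
    and BCQ: "\<And>z. z \<in> feasible_set {1..p} g \<Longrightarrow> norm (z - ubar) \<le> \<delta> \<Longrightarrow> BCQ {1..p} g z"
  shows "\<exists>x \<in> {z \<in> feasible_set {1..p} g. norm (z - ubar) \<le> \<delta>}.
    \<exists>lam \<mu> :: nat \<Rightarrow> real.
      (\<forall>k\<in>{1..m}. lam k \<ge> 0) \<and> (\<Sum>k\<in>{1..m}. lam k) = 1 \<and> (\<forall>j\<in>{1..p}. \<mu> j \<ge> 0) \<and>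
      0 \<in> (\<Sum>k\<in>{1..m}. (\<lambda>v. lam k *\<^sub>R v) ` weak_gradient (F k) x)
          + (\<Sum>j\<in>active {1..p} g x. (\<lambda>v. \<mu> j *\<^sub>R v) ` Clarke_gradient (g j) x)
          + (\<lambda>v. (1 / \<delta> * (MAX k\<in>{1..m}. \<epsilon> k)) *\<^sub>R v) ` cball 0 1 \<and>
      (\<forall>j\<in>{1..p}. \<mu> j * g j x = 0)"
proof -
  let ?K = "{1..m}" and ?J = "{1..p}"
  define E where "E = (MAX k\<in>?K. \<epsilon> k)"
  obtain k0 where "k0 \<in> ?K" "\<epsilon> k0 > 0"
    using eps_nonzero eps_nonneg by (metis order_le_less)
  hence K: "?K \<noteq> {}" and "E > 0"
    unfolding E_def by (auto simp: Max_gr_iff)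
  \<comment> \<open>The halves coming from center and half-width give a radius that is half of the
    one claimed.\<close>
  define c where "c = E / (2 * \<delta>)"
  have c: "0 \<le> c" "c \<le> E / \<delta>" using delta \<open>E > 0\<close> by (simp_all add: c_def field_simps)
  obtain x \<alpha> \<beta> where x: "x \<in> feasible_set ?J g" "norm (x - ubar) \<le> \<delta>"
    and at_x: "\<And>k. k \<in> ?K \<Longrightarrow> center (F k x) \<le> \<alpha> k \<and> half_width (F k x) \<le> \<beta> k"
    and minimal: "\<And>z. z \<in> feasible_set ?J g \<Longrightarrow> \<exists>k\<in>?K. \<alpha> k \<le> center (F k z) + c * norm (z - x) \<or>
      \<beta> k \<le> half_width (F k z) + c * norm (z - x)"
    using approx_solution_penalized_minimizer[OF _ K F eps_nonneg _ closed_feasible_set[OF g] ubar delta]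
      \<open>E > 0\<close> unfolding c_def E_def by (metis finite_atLeastAtMost)
  obtain t \<nu> \<xi> \<zeta> where
    t: "\<And>k. k \<in> ?K \<Longrightarrow> t k \<ge> 0" and \<nu>: "\<And>j. j \<in> active ?J g x \<Longrightarrow> \<nu> j \<ge> 0"
    and total: "sum t ?K + sum \<nu> (active ?J g x) = 1"
    and \<xi>: "\<And>k. k \<in> ?K \<Longrightarrow> \<xi> k \<in> weak_gradient (F k) x"
    and \<zeta>: "\<And>j. j \<in> active ?J g x \<Longrightarrow> \<zeta> j \<in> Clarke_gradient (g j) x"
    and bound: "norm ((\<Sum>k\<in>?K. t k *\<^sub>R \<xi> k) + (\<Sum>j\<in>active ?J g x. \<nu> j *\<^sub>R \<zeta> j)) \<le> c * sum t ?K"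
    by (rule Fritz_John_penalized[OF finite_atLeastAtMost finite_atLeastAtMost F g x(1) c(1) at_x minimal])
      (assumption | (rule that; (assumption | blast)))+
  define \<tau> where "\<tau> = sum t ?K"
  \<comment> \<open>If \<open>\<tau>\<close> vanished, so would the objective part and the residual
    bound. The active constraint gradients, with weights of sum one, would then combine to
    \<open>0\<close>, against \<open>BCQ\<close> at \<open>x\<close>.\<close>
  have "\<tau> \<noteq> 0"
  proof
    assume "\<tau> = 0"
    hence "\<forall>k\<in>?K. t k = 0" unfolding \<tau>_def using t by (subst (asm) sum_nonneg_eq_0_iff) auto
    hence "(\<Sum>k\<in>?K. t k *\<^sub>R \<xi> k) = 0" by simp
    hence "(\<Sum>j\<in>active ?J g x. \<nu> j *\<^sub>R \<zeta> j) = 0"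
      using bound \<open>\<tau> = 0\<close> by (simp add: \<tau>_def)
    moreover have "sum \<nu> (active ?J g x) > 0" using total \<open>\<tau> = 0\<close> by (simp add: \<tau>_def)
    ultimately show False
      using BCQ_sum_nonzero[OF BCQ[OF x] _ g \<nu> _ \<zeta>] by simp
  qed
  moreover have "\<tau> \<ge> 0" unfolding \<tau>_def by (rule sum_nonneg) (rule t)
  ultimately have "\<tau> > 0" by simp
  define lam where "lam k = t k / \<tau>" for k
  \<comment> \<open>The value zero off the active set yields complementarity for every
    index.\<close>
  define \<mu> where "\<mu> j = (if j \<in> active ?J g x then \<nu> j / \<tau> else 0)" for j
  define a where "a = (\<Sum>k\<in>?K. lam k *\<^sub>R \<xi> k)"
  define b where "b = (\<Sum>j\<in>active ?J g x. \<mu> j *\<^sub>R \<zeta> j)"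
  define W where "W = (\<Sum>k\<in>?K. t k *\<^sub>R \<xi> k) + (\<Sum>j\<in>active ?J g x. \<nu> j *\<^sub>R \<zeta> j)"
  have "a + b = (1 / \<tau>) *\<^sub>R W"
    by (simp add: W_def a_def b_def lam_def \<mu>_def scaleR_add_right scaleR_sum_right)
  hence "norm (a + b) = norm W / \<tau>" using \<open>\<tau> > 0\<close> by simp
  also have "\<dots> \<le> c"
    using bound \<open>\<tau> > 0\<close> unfolding W_def[symmetric] \<tau>_def[symmetric] by (simp add: field_simps)
  finally have ab: "norm (a + b) \<le> E / \<delta>" using c by simp
  have "a \<in> (\<Sum>k\<in>?K. (\<lambda>v. lam k *\<^sub>R v) ` weak_gradient (F k) x)"
    unfolding a_def using \<xi> by (intro sum_mem_set_sum) auto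
  moreover have "b \<in> (\<Sum>j\<in>active ?J g x. (\<lambda>v. \<mu> j *\<^sub>R v) ` Clarke_gradient (g j) x)"
    unfolding b_def using \<zeta> by (intro sum_mem_set_sum) (auto simp: active_def)
  \<comment> \<open>The ball contributes the negated residual, so that the three summands add up to
    \<open>0\<close>; its preimage in the unit ball exists because \<open>E > 0\<close>.\<close>
  moreover have "- (a + b) \<in> (\<lambda>v. (1 / \<delta> * E) *\<^sub>R v) ` cball 0 1"
  proof (rule image_eqI)
    show "- (a + b) = (1 / \<delta> * E) *\<^sub>R (- (\<delta> / E) *\<^sub>R (a + b))"
      using delta \<open>E > 0\<close> by simp
    show "- (\<delta> / E) *\<^sub>R (a + b) \<in> cball 0 1"
      using ab delta \<open>E > 0\<close> unfolding mem_cball_0 norm_scaleR by (simp add: field_simps)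
  qed
  ultimately have "a + b + - (a + b) \<in> (\<Sum>k\<in>?K. (\<lambda>v. lam k *\<^sub>R v) ` weak_gradient (F k) x)
      + (\<Sum>j\<in>active ?J g x. (\<lambda>v. \<mu> j *\<^sub>R v) ` Clarke_gradient (g j) x)
      + (\<lambda>v. (1 / \<delta> * E) *\<^sub>R v) ` cball 0 1"
    by (intro set_plus_intro)
  moreover have "\<forall>k\<in>?K. lam k \<ge> 0" "\<forall>j\<in>?J. \<mu> j \<ge> 0" "\<forall>j\<in>?J. \<mu> j * g j x = 0"
    using t \<nu> \<open>\<tau> > 0\<close> by (auto simp: lam_def \<mu>_def active_def)
  moreover have "sum lam ?K = 1"
    using \<open>\<tau> > 0\<close> by (simp add: lam_def \<tau>_def sum_divide_distrib[symmetric])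
  ultimately show ?thesis
    using x unfolding E_def by (intro bexI[of _ x] exI[of _ lam] exI[of _ \<mu>]) auto
qed

end
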